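(* Let $P$ be a pseudo-loop condition of width $m\geq 2$ and arity $n\geq 1$, and let $\mathscr{C}$ be a closed oligomorphic core clone on an at most countable domain $C$. The following are equivalent: (a) $\mathscr{C}$ satisfies $P$ locally; (b) $\mathscr{C}$ satisfies $P$; (c) for every $N \geq 1$ and every $R \subseteq (C^N)^m$ preserved by $\mathscr{C}^N$, if there is a homomorphism from $R_{P}$ to $R$, then $R$ has a pseudo-loop with respect to $\mathscr{C}$; (d) for every $N\geq 1$ and every $R \subseteq (C^N)^m$ preserved by $\mathscr{C}^N$, if there is an injective homomorphism from $R_{P}$ to $R$, then $R$ has a pseudo-loop with respect to $\mathscr{C}$.
   Context: A function clone $\mathscr{C}$ on a set $C$ is a set of operations on $C$ of finite arity $\ge 1$ containing all projections and closed under composition. $\operatorname{Gr}(\mathscr{C})$ is the group of all unary bijections in $\mathscr{C}$ whose inverse is also in $\mathscr{C}$. $\mathscr{C}$ is oligomorphic if $\operatorname{Gr}(\mathscr{C})$ has finitely many orbits in its componentwise action on $C^k$ for every $k\ge 1$. $\mathscr{C}$ is closed if it is topologically closed in the set of all finitary operations on $C$ with the topology of pointwise convergence ($C$ discrete), equivalently if it is the set of all finitary operations preserving all relations of some relational structure on $C$. $\mathscr{C}$ is a core if $\operatorname{Gr}(\mathscr{C})$ is dense (pointwise topology) in the unary functions of $\mathscr{C}$. $\mathscr{C}^N$ is the function clone on $C^N$ given by the componentwise action of $\mathscr{C}$ on $C^N$. A pseudo-loop condition of width $m\ge 2$ and arity $n\ge 1$ is a set $P$ of identities $u_1\circ f(x_{1,1},\ldots,x_{1,n})\approx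 u_2\circ f(x_{2,1},\ldots,x_{2,n})\approx\cdots\approx u_m\circ f(x_{m,1},\ldots,x_{m,n})$, with $f$ an $n$-ary and $u_1,\dots,u_m$ unary function symbols, and variables $x_{i,j}$ from a finite set; let $V=\{x_{1,1},\dots,x_{m,n}\}$ and $R_P:=\{(x_{1,i},\ldots,x_{m,i})\mid 1\le i\le n\}\subseteq V^m$. $\mathscr{C}$ satisfies $P$ if the symbols can be assigned functions of $\mathscr{C}$ so that the equations hold for all values of the variables in $C$; $\mathscr{C}$ satisfies $P$ locally if for every finite $F\subseteq C$ there is an assignment of functions of $\mathscr{C}$ to the symbols such that the equations hold for all values of the variables in $F$. A clone on $B$ preserves $R\subseteq B^m$ if $g(r_1,\dots,r_k)\in R$ (computed componentwise) for every $k$-ary $g$ in the clone and all $r_1,\dots,r_k\in R$. A homomorphism from $R_P$ to $R\subseteq B^m$ is a map $h\colon V\to B$ with $(h(v_1),\dots,h(v_m))\in R$ whenever $(v_1,\dots,v_m)\in R_P$. A pseudo-loop of $R\subseteq (C^N)^m$ with respect to $\mathscr{C}$ is a tuple $(a_1,\dots,a_m)\in R$ such that $a_1,\dots,a_m$ lie in the same orbit of $\operatorname{Gr}(\mathscr{C})$ acting componentwise on $C^N$ (i.e. of $\operatorname{Gr}(\mathscr{C}^N)$). *)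

theory Defs
  imports
    "HOL-Analysis.Analysis"
    "HOL-Algebra.Bij"
    "HOL-Algebra.Group_Action"
    "HOL-Library.NList"
begin

text \<open>
  Tuples in \<open>C\<^sup>k\<close> are lists in \<^term>\<open>nlists k C\<close>. A \<open>k\<close>-ary operation on \<open>C\<close> is a pair \<open>(k, f)\<close>
  where \<open>f\<close> maps \<^term>\<open>nlists k C\<close> to \<open>C\<close> and is extensional, so that distinct pairs are distinct
  operations. Carrier sets rather than types are used because \<open>N\<close> varies in the domains \<open>C\<^sup>N\<close>
  of the power clones.
\<close>

definition operations :: "'a set \<Rightarrow> (nat \<times> ('a list \<Rightarrow> 'a)) set" where
  "operations C = (SIGMA k:{1..}. nlists k C \<rightarrow>\<^sub>E C)"

definition projection :: "'a set \<Rightarrow> nat \<Rightarrow> nat \<Rightarrow> 'a list \<Rightarrow> 'a" where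
  "projection C k i = (\<lambda>xs\<in>nlists k C. xs ! i)"

definition composition ::
  "'a set \<Rightarrow> nat \<Rightarrow> ('a list \<Rightarrow> 'a) \<Rightarrow> ('a list \<Rightarrow> 'a) list \<Rightarrow> 'a list \<Rightarrow> 'a" where
  "composition C l f gs = (\<lambda>xs\<in>nlists l C. f (map (\<lambda>g. g xs) gs))"

definition function_clone :: "'a set \<Rightarrow> (nat \<times> ('a list \<Rightarrow> 'a)) set \<Rightarrow> bool" where
  "function_clone C \<C> \<longleftrightarrow>
     \<C> \<subseteq> operations C \<and>
     (\<forall>k\<ge>1. \<forall>i<k. (k, projection C k i) \<in> \<C>) \<and>
     (\<forall>k l f gs. (k, f) \<in> \<C> \<longrightarrow> length gs = k \<longrightarrow> (\<forall>g\<in>set gs. (l, g) \<in> \<C>) \<longrightarrow>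
        (l, composition C l f gs) \<in> \<C>)"

text \<open>Unary members of a clone, viewed as functions on \<open>C\<close> instead of on one-element tuples.\<close>

definition unary_functions :: "'a set \<Rightarrow> (nat \<times> ('a list \<Rightarrow> 'a)) set \<Rightarrow> ('a \<Rightarrow> 'a) set" where
  "unary_functions C \<C> = {u \<in> C \<rightarrow>\<^sub>E C. (1, \<lambda>xs\<in>nlists 1 C. u (hd xs)) \<in> \<C>}"

definition Gr :: "'a set \<Rightarrow> (nat \<times> ('a list \<Rightarrow> 'a)) set \<Rightarrow> ('a \<Rightarrow> 'a) monoid" where
  "Gr C \<C> = BijGroup C
     \<lparr>carrier := {g \<in> Bij C. g \<in> unary_functions C \<C> \<and>
        inv\<^bsub>BijGroup C\<^esub> g \<in> unary_functions C \<C>}\<rparr>"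

definition tuple_action :: "'a set \<Rightarrow> nat \<Rightarrow> ('a \<Rightarrow> 'a) \<Rightarrow> 'a list \<Rightarrow> 'a list" where
  "tuple_action C k g = restrict (map g) (nlists k C)"

definition oligomorphic :: "'a set \<Rightarrow> (nat \<times> ('a list \<Rightarrow> 'a)) set \<Rightarrow> bool" where
  "oligomorphic C \<C> \<longleftrightarrow>
     (\<forall>k\<ge>1. finite (orbits (Gr C \<C>) (nlists k C) (tuple_action C k)))"

text \<open>Pointwise convergence on functions from \<open>A\<close> to \<open>C\<close>, with \<open>C\<close> discrete.\<close>

definition pointwise_topology :: "'i set \<Rightarrow> 'a set \<Rightarrow> ('i \<Rightarrow> 'a) topology" where
  "pointwise_topology A C = product_topology (\<lambda>_. discrete_topology C) A"

definition closed_clone :: "'a set \<Rightarrow> (nat \<times> ('a list \<Rightarrow> 'a)) set \<Rightarrow> bool" where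
  "closed_clone C \<C> \<longleftrightarrow>
     closedin (sum_topology (\<lambda>k. pointwise_topology (nlists k C) C) {1..}) \<C>"

definition core_clone :: "'a set \<Rightarrow> (nat \<times> ('a list \<Rightarrow> 'a)) set \<Rightarrow> bool" where
  "core_clone C \<C> \<longleftrightarrow>
     subtopology (pointwise_topology C C) (unary_functions C \<C>) closure_of carrier (Gr C \<C>)
       = unary_functions C \<C>"

definition componentwise :: "nat \<Rightarrow> ('a list \<Rightarrow> 'a) \<Rightarrow> 'a list list \<Rightarrow> 'a list" where
  "componentwise N f rs = map (\<lambda>i. f (map (\<lambda>r. r ! i) rs)) [0..<N]"

definition clone_power ::
  "'a set \<Rightarrow> nat \<Rightarrow> (nat \<times> ('a list \<Rightarrow> 'a)) set \<Rightarrow> (nat \<times> ('a list list \<Rightarrow> 'a list)) set" where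
  "clone_power C N \<C> = {(k, restrict (componentwise N f) (nlists k (nlists N C))) | k f. (k, f) \<in> \<C>}"

definition preserves :: "(nat \<times> ('b list \<Rightarrow> 'b)) set \<Rightarrow> nat \<Rightarrow> 'b list set \<Rightarrow> bool" where
  "preserves \<G> m R \<longleftrightarrow> (\<forall>(k, g)\<in>\<G>. \<forall>rs\<in>nlists k R. componentwise m g rs \<in> R)"

text \<open>
  A pseudo-loop condition is given by the \<open>m \<times> n\<close> matrix \<open>P\<close> of its variables: row \<open>i\<close> is the list
  of arguments of \<open>f\<close> in the \<open>i\<close>-th term \<open>u\<^sub>i \<circ> f(x\<^sub>i\<^sub>,\<^sub>1, \<dots>, x\<^sub>i\<^sub>,\<^sub>n)\<close>. Indices start at \<open>0\<close>.
\<close>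

definition pseudo_loop_condition :: "nat \<Rightarrow> nat \<Rightarrow> 'v list list \<Rightarrow> bool" where
  "pseudo_loop_condition m n P \<longleftrightarrow> m \<ge> 2 \<and> n \<ge> 1 \<and> P \<in> nlists m (nlists n UNIV)"

definition variables :: "'v list list \<Rightarrow> 'v set" where
  "variables P = (\<Union>row\<in>set P. set row)"

definition condition_relation :: "nat \<Rightarrow> 'v list list \<Rightarrow> 'v list set" where
  "condition_relation n P = {map (\<lambda>row. row ! j) P | j. j < n}"

definition satisfies_on ::
  "(nat \<times> ('a list \<Rightarrow> 'a)) set \<Rightarrow> nat \<Rightarrow> nat \<Rightarrow> 'v list list \<Rightarrow> 'a set \<Rightarrow> bool" where
  "satisfies_on \<C> m n P F \<longleftrightarrow>
     (\<exists>f u. (n, f) \<in> \<C> \<and> (\<forall>i<m. (1, u i) \<in> \<C>) \<and>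
        (\<forall>s\<in>variables P \<rightarrow> F. \<forall>i<m. \<forall>j<m. u i [f (map s (P ! i))] = u j [f (map s (P ! j))]))"

definition satisfies ::
  "'a set \<Rightarrow> (nat \<times> ('a list \<Rightarrow> 'a)) set \<Rightarrow> nat \<Rightarrow> nat \<Rightarrow> 'v list list \<Rightarrow> bool" where
  "satisfies C \<C> m n P \<longleftrightarrow> satisfies_on \<C> m n P C"

definition satisfies_locally ::
  "'a set \<Rightarrow> (nat \<times> ('a list \<Rightarrow> 'a)) set \<Rightarrow> nat \<Rightarrow> nat \<Rightarrow> 'v list list \<Rightarrow> bool" where
  "satisfies_locally C \<C> m n P \<longleftrightarrow> (\<forall>F. finite F \<and> F \<subseteq> C \<longrightarrow> satisfies_on \<C> m n P F)"

definition relation_homomorphism ::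
  "'v set \<Rightarrow> 'v list set \<Rightarrow> 'b set \<Rightarrow> 'b list set \<Rightarrow> ('v \<Rightarrow> 'b) \<Rightarrow> bool" where
  "relation_homomorphism V S B R h \<longleftrightarrow> h \<in> V \<rightarrow> B \<and> (\<forall>v\<in>S. map h v \<in> R)"

definition pseudo_loop ::
  "'a set \<Rightarrow> (nat \<times> ('a list \<Rightarrow> 'a)) set \<Rightarrow> nat \<Rightarrow> 'a list list set \<Rightarrow> 'a list list \<Rightarrow> bool" where
  "pseudo_loop C \<C> N R a \<longleftrightarrow>
     a \<in> R \<and> (\<exists>\<Omega>\<in>orbits (Gr C \<C>) (nlists N C) (tuple_action C N). set a \<subseteq> \<Omega>)"

end

theory Submission
  imports Defs
begin

text \<open>
  If \<open>u\<^sub>1, \<dots>, u\<^sub>m\<close> and \<open>f\<close> witness \<open>P\<close>, then \<open>f\<close> maps the homomorphic images of the tuples of the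
  condition relation to a tuple of \<open>R\<close> whose entries are identified by the \<open>u\<^sub>i\<close>; since \<open>\<C>\<close> is a
  core, each \<open>u\<^sub>i\<close> agrees on finitely many values with an element of the group, so this tuple is a
  pseudo-loop. Conversely, for a finite \<open>F\<close> with at least two elements let the coordinates of
  \<open>C\<^sup>N\<close> be the assignments \<open>V \<rightarrow> F\<close>. Evaluation at \<open>v \<in> V\<close> is an injective map into \<open>C\<^sup>N\<close>, and the
  relation generated by the images of the condition relation consists of the tuples of value
  tables of the terms \<open>f(x\<^sub>i)\<close>, for \<open>f \<in> \<C>\<close>; a pseudo-loop in it is a local solution on \<open>F\<close>.

  Local solutions are made global by Koenig's lemma modulo the group: modulo left composition with
  group elements there are only finitely many restrictions to a finite set, by oligomorphicity.
  This is applied first to \<open>f\<close>, where \<open>u\<^sub>i\<close> becomes \<open>u\<^sub>i \<circ> g\<^sup>-\<^sup>1\<close> when \<open>f\<close> becomes \<open>g \<circ> f\<close>, and then,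
  for the resulting \<open>f\<close>, to \<open>(u\<^sub>1, \<dots>, u\<^sub>m)\<close> with simultaneous left composition.
\<close>

section \<open>Pointwise approximation\<close>

text \<open>Such a set is a box in the product: singletons on \<open>J\<close>, the full factor
  \<open>C\<close> elsewhere. Finiteness of \<open>J\<close> makes the box open.\<close>

lemma openin_cylinder:
  assumes "f \<in> A \<rightarrow>\<^sub>E C" "finite J" "J \<subseteq> A"
  shows "openin (pointwise_topology A C) {g \<in> A \<rightarrow>\<^sub>E C. \<forall>x\<in>J. g x = f x}"
proof -
  let ?U = "\<lambda>x. if x \<in> J then {f x} else C"
  have fC: "f x \<in> C" if "x \<in> J" for x
    using assms(1,3) that by auto
  have "{g \<in> A \<rightarrow>\<^sub>E C. \<forall>x\<in>J. g x = f x} = Pi\<^sub>E A ?U"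
  proof (intro equalityI subsetI)
    fix g assume "g \<in> {g \<in> A \<rightarrow>\<^sub>E C. \<forall>x\<in>J. g x = f x}"
    then show "g \<in> Pi\<^sub>E A ?U"
      by (simp add: PiE_iff)
  next
    fix g assume g: "g \<in> Pi\<^sub>E A ?U"
    have "g x = f x" if "x \<in> J" for x
      using PiE_mem[OF g, of x] that assms(3) by auto
    moreover have "g x \<in> C" if "x \<in> A" for x
      using PiE_mem[OF g that] fC by (cases "x \<in> J") auto
    ultimately show "g \<in> {g \<in> A \<rightarrow>\<^sub>E C. \<forall>x\<in>J. g x = f x}"
      using g by (simp add: PiE_iff)
  qed
  moreover have "finite {x \<in> A. ?U x \<noteq> C}"
    by (rule finite_subset[OF _ assms(2)]) (simp add: subset_iff)
  then have "openin (pointwise_topology A C) (Pi\<^sub>E A ?U)"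
    unfolding pointwise_topology_def openin_PiE_gen using fC by simp
  ultimately show ?thesis
    by simp
qed

lemma topspace_pointwise [simp]: "topspace (pointwise_topology A C) = A \<rightarrow>\<^sub>E C"
  by (simp add: pointwise_topology_def)

lemma closure_of_pointwise_approx:
  assumes "f \<in> pointwise_topology A C closure_of S" "finite J" "J \<subseteq> A"
  obtains g where "g \<in> S" "\<And>x. x \<in> J \<Longrightarrow> g x = f x"
proof -
  have f: "f \<in> A \<rightarrow>\<^sub>E C"
    using assms(1) by (simp add: in_closure_of)
  let ?T = "{g \<in> A \<rightarrow>\<^sub>E C. \<forall>x\<in>J. g x = f x}"
  have "\<exists>g. g \<in> S \<and> g \<in> ?T"
    using assms(1) openin_cylinder[OF f assms(2,3)] f unfolding in_closure_of
    by (elim conjE allE[of _ ?T]) simp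
  then show ?thesis
    using that by blast
qed

text \<open>A basic neighbourhood of \<open>f\<close> constrains only finitely many coordinates.
  Taking these as \<open>J\<close>, an approximant of \<open>f\<close> on \<open>J\<close> lies in
  the neighbourhood, so \<open>f\<close> is in the closure of \<open>S\<close>.\<close>

lemma closed_pointwise_limit:
  assumes "closedin (pointwise_topology A C) S" and f: "f \<in> A \<rightarrow>\<^sub>E C"
    and approx: "\<And>J. finite J \<Longrightarrow> J \<subseteq> A \<Longrightarrow> \<exists>g\<in>S. \<forall>x\<in>J. g x = f x"
  shows "f \<in> S"
proof -
  have "f \<in> pointwise_topology A C closure_of S"
    unfolding in_closure_of
  proof (intro conjI allI impI; (erule conjE)?)
    fix T assume T: "f \<in> T" "openin (pointwise_topology A C) T"
    obtain U where U: "finite {x \<in> A. U x \<noteq> C}" "f \<in> Pi\<^sub>E A U" "Pi\<^sub>E A U \<subseteq> T"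
      using bspec[OF T(2)[unfolded pointwise_topology_def openin_product_topology_alt] T(1)]
      unfolding topspace_discrete_topology by blast
    obtain g where g: "g \<in> S" "\<forall>x\<in>{x \<in> A. U x \<noteq> C}. g x = f x"
      using approx[OF U(1)] by auto
    have gC: "g \<in> A \<rightarrow>\<^sub>E C"
      using g(1) closedin_subset[OF assms(1)] by auto
    have "g \<in> Pi\<^sub>E A U"
    proof (rule PiE_I)
      fix x assume "x \<in> A"
      then show "g x \<in> U x"
        using g(2) PiE_mem[OF U(2)] PiE_mem[OF gC] by (cases "U x = C") auto
    next
      fix x assume "x \<notin> A"
      then show "g x = undefined"
        using PiE_arb[OF gC] by simp
    qed
    then show "\<exists>y. y \<in> S \<and> y \<in> T"
      using g(1) U(3) by blast
  next
    show "f \<in> topspace (pointwise_topology A C)"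
      using f by simp
  qed
  then show ?thesis
    unfolding closure_of_closedin[OF assms(1)] .
qed

text \<open>Closedness in the sum topology is tested on each summand, that is, separately for each
  arity.\<close>

lemma closed_clone_limit:
  assumes "closed_clone C \<C>" "k \<ge> 1" "f \<in> nlists k C \<rightarrow>\<^sub>E C"
    and "\<And>J. finite J \<Longrightarrow> J \<subseteq> nlists k C \<Longrightarrow> \<exists>g. (k, g) \<in> \<C> \<and> (\<forall>x\<in>J. g x = f x)"
  shows "(k, f) \<in> \<C>"
proof -
  have "closedin (pointwise_topology (nlists k C) C) {g. (k, g) \<in> \<C>}"
    using assms(1,2) unfolding closed_clone_def closedin_sum_topology by auto
  then have "f \<in> {g. (k, g) \<in> \<C>}"
    by (rule closed_pointwise_limit) (use assms in auto)
  then show ?thesis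
    by simp
qed

text \<open>The core property takes the closure inside the subspace of unary functions. That closure
  lies in the closure in the whole product, where finite approximation is available.\<close>

lemma core_clone_approx:
  assumes "core_clone C \<C>" "u \<in> unary_functions C \<C>" "finite J" "J \<subseteq> C"
  obtains g where "g \<in> carrier (Gr C \<C>)" "\<And>x. x \<in> J \<Longrightarrow> g x = u x"
proof -
  have "u \<in> pointwise_topology C C closure_of carrier (Gr C \<C>)"
    by (rule subsetD[OF closure_of_subtopology_subset[of _ "unary_functions C \<C>"]])
      (use assms(1,2) in \<open>simp only: core_clone_def\<close>)
  then obtain g where "g \<in> carrier (Gr C \<C>)" "\<And>x. x \<in> J \<Longrightarrow> g x = u x"
    using closure_of_pointwise_approx[OF _ assms(3,4)] by metis
  then show ?thesis
    by (rule that)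
qed

section \<open>Unary functions and invertible elements of a clone\<close>

lemma clone_extensional:
  assumes "function_clone C \<C>" "(k, f) \<in> \<C>"
  shows "f \<in> nlists k C \<rightarrow>\<^sub>E C"
proof -
  have "(k, f) \<in> operations C"
    using assms unfolding function_clone_def by (elim conjE) (rule subsetD)
  then show ?thesis
    by (simp add: operations_def)
qed

lemma clone_apply_in:
  assumes "function_clone C \<C>" "(k, f) \<in> \<C>" "xs \<in> nlists k C"
  shows "f xs \<in> C"
  using clone_extensional[OF assms(1,2)] assms(3) by (rule PiE_mem)

lemma clone_projection:
  assumes "function_clone C \<C>" "i < k"
  shows "(k, projection C k i) \<in> \<C>"
  using assms unfolding function_clone_def by simp

lemma clone_composition:
  assumes "function_clone C \<C>" "(k, f) \<in> \<C>" "length gs = k" "\<And>g. g \<in> set gs \<Longrightarrow> (l, g) \<in> \<C>"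
  shows "(l, composition C l f gs) \<in> \<C>"
proof -
  have "\<forall>k l f gs. (k, f) \<in> \<C> \<longrightarrow> length gs = k \<longrightarrow> (\<forall>g\<in>set gs. (l, g) \<in> \<C>) \<longrightarrow>
      (l, composition C l f gs) \<in> \<C>"
    using assms(1) unfolding function_clone_def by (elim conjE)
  then show ?thesis
    using assms(2-4) by simp
qed

lemma unary_functions_in: "u \<in> unary_functions C \<C> \<Longrightarrow> x \<in> C \<Longrightarrow> u x \<in> C"
  using PiE_mem[of u C "\<lambda>_. C" x] by (simp add: unary_functions_def)

lemma clone_unary_compose:
  assumes cl: "function_clone C \<C>" and u: "u \<in> unary_functions C \<C>" and f: "(k, f) \<in> \<C>"
  shows "(k, \<lambda>xs\<in>nlists k C. u (f xs)) \<in> \<C>"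
proof -
  let ?u = "\<lambda>xs\<in>nlists 1 C. u (hd xs)"
  have "(1, ?u) \<in> \<C>"
    using u by (simp add: unary_functions_def)
  then have "(k, composition C k ?u [f]) \<in> \<C>"
    by (rule clone_composition[OF cl]) (use f in auto)
  moreover have "composition C k ?u [f] = (\<lambda>xs\<in>nlists k C. u (f xs))"
    unfolding composition_def by (rule restrict_ext) (use clone_apply_in[OF cl f] in simp)
  ultimately show ?thesis
    by simp
qed

text \<open>Since \<open>u\<close> is extensional, it is recovered from its version on points by
  reading heads of one-element lists; thus the two encodings of unary operations can be
  exchanged.\<close>

lemma unary_functions_of_clone:
  assumes cl: "function_clone C \<C>" and u: "(1, u) \<in> \<C>"
  shows "(\<lambda>x\<in>C. u [x]) \<in> unary_functions C \<C>"
proof -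
  have "(\<lambda>xs\<in>nlists 1 C. (\<lambda>x\<in>C. u [x]) (hd xs)) = u"
  proof
    fix xs
    show "(\<lambda>xs\<in>nlists 1 C. (\<lambda>x\<in>C. u [x]) (hd xs)) xs = u xs"
    proof (cases "xs \<in> nlists 1 C")
      case True
      then show ?thesis
        by (auto simp: in_nlists_Suc_iff)
    next
      case False
      then show ?thesis
        by (simp add: PiE_arb[OF clone_extensional[OF cl u] False])
    qed
  qed
  moreover have "u [x] \<in> C" if "x \<in> C" for x
    by (rule clone_apply_in[OF cl u]) (use that in simp)
  ultimately show ?thesis
    unfolding unary_functions_def using u by simp
qed

lemma unary_functions_compose:
  assumes cl: "function_clone C \<C>" and u: "u \<in> unary_functions C \<C>" and v: "v \<in> unary_functions C \<C>"
  shows "(\<lambda>x\<in>C. u (v x)) \<in> unary_functions C \<C>"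
proof -
  have "(1, \<lambda>xs\<in>nlists 1 C. v (hd xs)) \<in> \<C>"
    using v by (simp add: unary_functions_def)
  from unary_functions_of_clone[OF cl clone_unary_compose[OF cl u this]]
  show ?thesis
    by (simp cong: restrict_cong)
qed

section \<open>The group of invertible unary functions and its orbits on tuples\<close>

lemma mem_Gr_iff:
  "g \<in> carrier (Gr C \<C>) \<longleftrightarrow>
    g \<in> Bij C \<and> g \<in> unary_functions C \<C> \<and> inv\<^bsub>BijGroup C\<^esub> g \<in> unary_functions C \<C>"
  by (simp add: Gr_def)

lemma Gr_unary: "g \<in> carrier (Gr C \<C>) \<Longrightarrow> g \<in> unary_functions C \<C>"
  by (simp add: mem_Gr_iff)

text \<open>Turns the inverse in \<open>BijGroup C\<close> into a pointwise cancellation law, the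
  form used later to go back along an orbit or to undo a group element applied to
  \<open>f\<close>.\<close>

lemma Gr_inverse:
  assumes "g \<in> carrier (Gr C \<C>)"
  obtains g' where "g' \<in> carrier (Gr C \<C>)" "\<And>x. x \<in> C \<Longrightarrow> g' (g x) = x"
proof -
  interpret B: group "BijGroup C"
    by (rule group_BijGroup)
  have carrier: "carrier (BijGroup C) = Bij C" and one: "\<one>\<^bsub>BijGroup C\<^esub> = (\<lambda>x\<in>C. x)"
    by (simp_all add: BijGroup_def)
  have mult: "f \<otimes>\<^bsub>BijGroup C\<^esub> h = compose C f h" if "f \<in> Bij C" "h \<in> Bij C" for f h
    using that by (simp add: BijGroup_def)
  have g: "g \<in> Bij C"
    using assms by (simp only: mem_Gr_iff)
  let ?g = "inv\<^bsub>BijGroup C\<^esub> g"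
  \<comment> \<open>Inverting twice returns \<open>g\<close>, so the membership condition of
    \<open>Gr\<close> is symmetric in an element and its inverse.\<close>
  have g': "?g \<in> Bij C" "inv\<^bsub>BijGroup C\<^esub> ?g = g"
    using B.inv_closed[of g] B.inv_inv[of g] g by (simp_all only: carrier)
  have "?g \<in> carrier (Gr C \<C>)"
    using assms g' by (simp only: mem_Gr_iff)
  moreover have "compose C ?g g = (\<lambda>x\<in>C. x)"
    using B.l_inv[of g] g by (simp only: carrier one mult[OF g'(1) g])
  then have "?g (g x) = x" if "x \<in> C" for x
    using that by (metis compose_eq restrict_apply')
  ultimately show ?thesis
    using that by blast
qed

lemma Gr_id:
  assumes "function_clone C \<C>"
  shows "(\<lambda>x\<in>C. x) \<in> carrier (Gr C \<C>)"
proof -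
  interpret B: group "BijGroup C"
    by (rule group_BijGroup)
  have "(\<lambda>x\<in>C. projection C 1 0 [x]) \<in> unary_functions C \<C>"
    by (rule unary_functions_of_clone[OF assms]) (rule clone_projection[OF assms], simp)
  moreover have "(\<lambda>x\<in>C. projection C 1 0 [x]) = (\<lambda>x\<in>C. x)"
    by (auto simp: projection_def)
  moreover have "inv\<^bsub>BijGroup C\<^esub> (\<lambda>x\<in>C. x) = (\<lambda>x\<in>C. x)"
    using B.inv_one by (simp add: BijGroup_def)
  ultimately show ?thesis
    using id_Bij[of C] by (simp only: mem_Gr_iff simp_thms)
qed

lemma mem_orbit_tuple_action:
  assumes "x \<in> nlists k C"
  shows "y \<in> orbit (Gr C \<C>) (tuple_action C k) x \<longleftrightarrow> (\<exists>g\<in>carrier (Gr C \<C>). y = map g x)"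
proof -
  have "tuple_action C k g x = map g x" for g
    using assms by (simp add: tuple_action_def)
  then show ?thesis
    unfolding orbit_def Bex_def by (simp only: mem_Collect_eq conj_commute)
qed

lemma map_in_nlists:
  assumes "xs \<in> nlists k A" "\<And>x. x \<in> A \<Longrightarrow> f x \<in> B"
  shows "map f xs \<in> nlists k B"
proof (rule nlistsI)
  show "set (map f xs) \<subseteq> B"
    using nlistsE_set[OF assms(1)] assms(2) by auto
qed (use assms(1) in simp)

section \<open>Compactness modulo an oligomorphic group\<close>

text \<open>Pigeonhole on finitely many orbits: some orbit is visited at infinitely many indices,
  and all these visits can be moved by the group to one representative \<open>t l0\<close> in
  it.\<close>

lemma oligomorphic_infinitely_often:
  fixes t :: "nat \<Rightarrow> 'a list"
  assumes cl: "function_clone C \<C>" and ol: "oligomorphic C \<C>" and "k \<ge> 1"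
    and t: "\<And>l. t l \<in> nlists k C"
  shows "\<exists>l0. \<forall>l. \<exists>l'\<ge>l. \<exists>g\<in>carrier (Gr C \<C>). map g (t l') = t l0"
proof -
  define orb where "orb = (\<lambda>l. orbit (Gr C \<C>) (tuple_action C k) (t l))"
  have "finite (range orb)"
    by (rule finite_subset[of _ "orbits (Gr C \<C>) (nlists k C) (tuple_action C k)"])
      (use t ol \<open>k \<ge> 1\<close> in \<open>auto simp: orb_def orbits_def oligomorphic_def\<close>)
  then obtain l0 where l0: "infinite {l. orb l = orb l0}"
    using pigeonhole_infinite[of "UNIV :: nat set" orb] by auto
  have t0: "t l0 \<in> orb l0"
    unfolding orb_def mem_orbit_tuple_action[OF t]
  proof (rule bexI[OF _ Gr_id[OF cl]])
    have "map (\<lambda>x\<in>C. x) (t l0) = t l0"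
      by (rule map_idI) (use nlistsE_set[OF t] in auto)
    then show "t l0 = map (\<lambda>x\<in>C. x) (t l0)" ..
  qed
  have "\<exists>l'\<ge>l. \<exists>g\<in>carrier (Gr C \<C>). map g (t l') = t l0" for l
  proof -
    obtain l' where l': "l' \<ge> l" "orb l' = orb l0"
      using l0 unfolding infinite_nat_iff_unbounded_le by blast
    then have "t l0 \<in> orb l'"
      using t0 by simp
    then show ?thesis
      using l'(1) unfolding orb_def mem_orbit_tuple_action[OF t] by metis
  qed
  then show ?thesis
    by blast
qed

text \<open>Here \<open>S l\<close> is the set of solutions at stage \<open>l\<close>, shrinking
  with \<open>l\<close>. A limit is built along an enumeration of \<open>I\<close>, one value at a
  time. The tree of prefixes need not branch finitely, but finiteness of the number of orbits on
  tuples takes the place of finite branching, because each \<open>S l\<close> is invariant under the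
  group.\<close>

lemma oligomorphic_compactness:
  fixes S :: "nat \<Rightarrow> ('i \<Rightarrow> 'a) set"
  assumes cl: "function_clone C \<C>" and ol: "oligomorphic C \<C>"
    and I: "countable I" "I \<noteq> {}"
    and S: "\<And>l. S l \<subseteq> I \<rightarrow> C" "\<And>l. S l \<noteq> {}" "antimono S"
    and inv: "\<And>l \<psi> g. \<psi> \<in> S l \<Longrightarrow> g \<in> carrier (Gr C \<C>) \<Longrightarrow> (\<lambda>x\<in>I. g (\<psi> x)) \<in> S l"
  shows "\<exists>\<phi>\<in>I \<rightarrow>\<^sub>E C. \<forall>l J. finite J \<longrightarrow> J \<subseteq> I \<longrightarrow> (\<exists>\<psi>\<in>S l. \<forall>x\<in>J. \<psi> x = \<phi> x)"
proof -
  \<comment> \<open>An enumeration of \<open>I\<close>, with repetitions if \<open>I\<close> is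
    finite.\<close>
  define e where "e = from_nat_into I"
  have eI: "e k \<in> I" for k
    by (simp add: e_def I(2) from_nat_into)
  \<comment> \<open>The prefixes that are realised at every stage; these are the nodes through which
    the branch may pass.\<close>
  define good where "good k xs \<longleftrightarrow> length xs = k \<and> (\<forall>l. \<exists>\<psi>\<in>S l. map (\<lambda>i. \<psi> (e i)) [0..<k] = xs)"
    for k and xs :: "'a list"
  have "\<exists>c. good (Suc k) (xs @ [c])" if "good k xs" for k xs
  proof -
    from that obtain \<psi> where \<psi>: "\<psi> l \<in> S l" "map (\<lambda>i. \<psi> l (e i)) [0..<k] = xs" for l
      unfolding good_def by metis
    \<comment> \<open>One-step extensions of \<open>xs\<close>, one from each stage. A group element
      carrying \<open>t l'\<close> to \<open>t l0\<close> automatically fixes the entries of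
      \<open>xs\<close>, since both tuples start with \<open>xs\<close>.\<close>
    define t where "t = (\<lambda>l. map (\<lambda>i. \<psi> l (e i)) [0..<Suc k])"
    have tC: "t l \<in> nlists (Suc k) C" for l
    proof -
      have "\<psi> l (e i) \<in> C" for i
        using subsetD[OF S(1) \<psi>(1)] eI by (rule funcset_mem)
      then show ?thesis
        unfolding t_def by (intro nlistsI) (simp_all del: upt_Suc add: image_subset_iff)
    qed
    have "\<exists>l0. \<forall>l. \<exists>l'\<ge>l. \<exists>g\<in>carrier (Gr C \<C>). map g (t l') = t l0"
      by (rule oligomorphic_infinitely_often[OF cl ol, of "Suc k" t]) (simp_all only: tC le_add2 flip: Suc_eq_plus1)
    then obtain l0 where l0: "\<forall>l. \<exists>l'\<ge>l. \<exists>g\<in>carrier (Gr C \<C>). map g (t l') = t l0"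
      by blast
    have t0: "t l0 = xs @ [\<psi> l0 (e k)]"
      using \<psi>(2) by (simp add: t_def)
    have "\<exists>\<psi>'\<in>S l. map (\<lambda>i. \<psi>' (e i)) [0..<Suc k] = t l0" for l
    proof -
      obtain l' g where g: "l' \<ge> l" "g \<in> carrier (Gr C \<C>)" "map g (t l') = t l0"
        using l0 by blast
      \<comment> \<open>The translated solution belongs to the later stage \<open>l'\<close>, hence
        to stage \<open>l\<close> because the sets decrease.\<close>
      have "(\<lambda>x\<in>I. g (\<psi> l' x)) \<in> S l"
        using inv[OF \<psi>(1) g(2)] antimonoD[OF S(3) g(1)] by blast
      moreover have "map (\<lambda>i. (\<lambda>x\<in>I. g (\<psi> l' x)) (e i)) [0..<Suc k] = t l0"
        using g(3) eI by (simp add: t_def)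
      ultimately show ?thesis
        by blast
    qed
    moreover have "length xs = k"
      using that by (simp add: good_def)
    ultimately have "good (Suc k) (t l0)"
      unfolding good_def by (simp add: t0)
    then show ?thesis
      using t0 by auto
  qed
  moreover have "good 0 []"
    using S(2) by (auto simp: good_def)
  \<comment> \<open>Dependent choice yields an infinite branch; \<open>d\<close> below collects its
    entries.\<close>
  ultimately obtain X where X: "good k (X k)" "\<exists>c. X (Suc k) = X k @ [c]" for k
    using dependent_nat_choice[of good "\<lambda>_ xs ys. \<exists>c. ys = xs @ [c]"] by metis
  define d where "d k = X (Suc k) ! k" for k
  have lenX: "length (X k) = k" for k
    using X(1) by (simp add: good_def)
  have nthX: "X k ! i = d i" if "i < k" for i k
    using that
  proof (induction k)
    case (Suc k)
    show ?case
    proof (cases "i = k")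
      case False
      then show ?thesis
        using Suc X(2)[of k] lenX[of k] by (auto simp: nth_append)
    qed (simp add: d_def)
  qed simp
  have approx: "\<exists>\<psi>\<in>S l. \<forall>i<k. \<psi> (e i) = d i" for l k
  proof -
    obtain \<psi> where \<psi>: "\<psi> \<in> S l" "map (\<lambda>i. \<psi> (e i)) [0..<k] = X k"
      using X(1) unfolding good_def by blast
    have "\<psi> (e i) = d i" if "i < k" for i
      using nthX[OF that] that unfolding \<psi>(2)[symmetric] by simp
    then show ?thesis
      using \<psi>(1) by blast
  qed
  \<comment> \<open>The value at \<open>x\<close> is read at the canonical index of
    \<open>x\<close>, so repetitions in the enumeration cause no ambiguity.\<close>
  define \<phi> where "\<phi> = (\<lambda>x\<in>I. d (to_nat_on I x))"
  have ex: "e (to_nat_on I x) = x" if "x \<in> I" for x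
    using that I by (simp add: e_def)
  have lim: "\<exists>\<psi>\<in>S l. \<forall>x\<in>J. \<psi> x = \<phi> x" if J: "finite J" "J \<subseteq> I" for l J
  proof -
    obtain k where k: "to_nat_on I ` J \<subseteq> {..<k}"
      using finite_nat_iff_bounded[of "to_nat_on I ` J"] finite_imageI[OF J(1)] by blast
    obtain \<psi> where \<psi>: "\<psi> \<in> S l" "\<forall>i<k. \<psi> (e i) = d i"
      using approx by blast
    have "\<psi> x = \<phi> x" if "x \<in> J" for x
    proof -
      have "to_nat_on I x < k" "x \<in> I"
        using k that \<open>J \<subseteq> I\<close> by auto
      then show ?thesis
        using \<psi>(2) ex[of x] by (metis \<phi>_def restrict_apply')
    qed
    then show ?thesis
      using \<psi>(1) by blast
  qed
  have "\<phi> x \<in> C" if xI: "x \<in> I" for x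
  proof -
    obtain \<psi> where "\<psi> \<in> S 0" "\<psi> x = \<phi> x"
      using lim[of "{x}" 0] xI by auto
    then show ?thesis
      using funcset_mem[OF subsetD[OF S(1)] xI] by metis
  qed
  then have "\<phi> \<in> I \<rightarrow>\<^sub>E C"
    by (auto simp: \<phi>_def)
  then show ?thesis
    by (intro bexI[of _ \<phi>] allI impI lim)
qed

section \<open>Pseudo-loop conditions\<close>

lemma condition_row:
  assumes "pseudo_loop_condition m n P" "i < m"
  shows "length (P ! i) = n" "set (P ! i) \<subseteq> variables P"
proof -
  have P: "P \<in> nlists m (nlists n UNIV)"
    using assms(1) by (simp add: pseudo_loop_condition_def)
  then have row: "P ! i \<in> set P"
    using assms(2) by simp
  show "length (P ! i) = n"
    using nlistsE_set[OF P] row by (blast intro: nlistsE_length)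
  show "set (P ! i) \<subseteq> variables P"
    unfolding variables_def using row by (rule UN_upper)
qed

lemma condition_length: "pseudo_loop_condition m n P \<Longrightarrow> length P = m"
  unfolding pseudo_loop_condition_def by (blast intro: nlistsE_length)

lemma finite_variables: "finite (variables P)"
  by (simp add: variables_def)

lemma map_row_in:
  assumes "pseudo_loop_condition m n P" "i < m" "s \<in> variables P \<rightarrow> F" "F \<subseteq> C"
  shows "map s (P ! i) \<in> nlists n C"
proof (rule nlistsI)
  show "length (map s (P ! i)) = n"
    using condition_row(1)[OF assms(1,2)] by simp
  show "set (map s (P ! i)) \<subseteq> C"
    using funcset_mem[OF assms(3)] condition_row(2)[OF assms(1,2)] assms(4) by auto
qed

text \<open>The identities of \<open>P\<close> for a fixed \<open>f\<close>, with the
  \<open>u i\<close> as maps on points. Keeping \<open>f\<close> and \<open>u\<close> as separate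
  arguments allows the two to be made global one after the other.\<close>

definition unary_solution ::
  "nat \<Rightarrow> 'v list list \<Rightarrow> 'a set \<Rightarrow> ('a list \<Rightarrow> 'a) \<Rightarrow> (nat \<Rightarrow> 'a \<Rightarrow> 'a) \<Rightarrow> bool" where
  "unary_solution m P F f u \<longleftrightarrow>
     (\<forall>s\<in>variables P \<rightarrow> F. \<forall>i<m. \<forall>j<m. u i (f (map s (P ! i))) = u j (f (map s (P ! j))))"

lemma unary_solutionD:
  assumes "unary_solution m P F f u" "s \<in> variables P \<rightarrow> F" "i < m" "j < m"
  shows "u i (f (map s (P ! i))) = u j (f (map s (P ! j)))"
  using assms(1)[unfolded unary_solution_def, rule_format, OF assms(2-4)] .

lemma satisfies_on_iff:
  assumes plc: "pseudo_loop_condition m n P" and cl: "function_clone C \<C>" and F: "F \<subseteq> C"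
  shows "satisfies_on \<C> m n P F \<longleftrightarrow>
    (\<exists>f u. (n, f) \<in> \<C> \<and> (\<forall>i<m. u i \<in> unary_functions C \<C>) \<and> unary_solution m P F f u)"
    (is "_ \<longleftrightarrow> ?rhs")
proof
  assume "satisfies_on \<C> m n P F"
  then obtain f u where f: "(n, f) \<in> \<C>" and u: "\<And>i. i < m \<Longrightarrow> (1, u i) \<in> \<C>"
    and eq: "\<And>s i j. s \<in> variables P \<rightarrow> F \<Longrightarrow> i < m \<Longrightarrow> j < m \<Longrightarrow>
      u i [f (map s (P ! i))] = u j [f (map s (P ! j))]"
    unfolding satisfies_on_def by blast
  have "unary_solution m P F f (\<lambda>i. \<lambda>x\<in>C. u i [x])"
    unfolding unary_solution_def
  proof (intro ballI allI impI)
    fix s i j assume s: "s \<in> variables P \<rightarrow> F" and ij: "i < m" "j < m"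
    have "f (map s (P ! i)) \<in> C" "f (map s (P ! j)) \<in> C"
      using clone_apply_in[OF cl f map_row_in[OF plc _ s F]] ij by blast+
    then show "(\<lambda>x\<in>C. u i [x]) (f (map s (P ! i))) = (\<lambda>x\<in>C. u j [x]) (f (map s (P ! j)))"
      using eq[OF s ij] by simp
  qed
  then show ?rhs
    using f unary_functions_of_clone[OF cl u]
    by (intro exI[of _ f] exI[of _ "\<lambda>i. \<lambda>x\<in>C. u i [x]"] conjI allI impI)
next
  assume ?rhs
  then obtain f u where f: "(n, f) \<in> \<C>" and u: "\<And>i. i < m \<Longrightarrow> u i \<in> unary_functions C \<C>"
    and eq: "\<And>s i j. s \<in> variables P \<rightarrow> F \<Longrightarrow> i < m \<Longrightarrow> j < m \<Longrightarrow>
      u i (f (map s (P ! i))) = u j (f (map s (P ! j)))"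
    unfolding unary_solution_def by blast
  show "satisfies_on \<C> m n P F"
    unfolding satisfies_on_def
  proof (intro exI[of _ f] exI[of _ "\<lambda>i. \<lambda>xs\<in>nlists 1 C. u i (hd xs)"] conjI allI impI ballI)
    show "(1, \<lambda>xs\<in>nlists 1 C. u i (hd xs)) \<in> \<C>" if "i < m" for i
      using u[OF that] by (simp add: unary_functions_def)
    fix s i j assume s: "s \<in> variables P \<rightarrow> F" and ij: "i < m" "j < m"
    have "f (map s (P ! i)) \<in> C" "f (map s (P ! j)) \<in> C"
      using clone_apply_in[OF cl f map_row_in[OF plc _ s F]] ij by blast+
    then show "(\<lambda>xs\<in>nlists 1 C. u i (hd xs)) [f (map s (P ! i))] =
        (\<lambda>xs\<in>nlists 1 C. u j (hd xs)) [f (map s (P ! j))]"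
      using eq[OF s ij] by simp
  qed (rule f)
qed

lemma satisfies_on_mono:
  assumes "satisfies_on \<C> m n P G" "F \<subseteq> G"
  shows "satisfies_on \<C> m n P F"
proof -
  have FG: "variables P \<rightarrow> F \<subseteq> variables P \<rightarrow> G"
    by (rule Pi_mono) (rule assms(2))
  obtain f u where fu: "(n, f) \<in> \<C>" "\<forall>i<m. (1, u i) \<in> \<C>"
    and eq: "\<forall>s\<in>variables P \<rightarrow> G. \<forall>i<m. \<forall>j<m.
      u i [f (map s (P ! i))] = u j [f (map s (P ! j))]"
    using assms(1) unfolding satisfies_on_def by (elim exE conjE)
  show ?thesis
    unfolding satisfies_on_def
    by (intro exI[of _ f] exI[of _ u] conjI fu ballI) (rule bspec[OF eq subsetD[OF FG]])
qed

text \<open>All values coincide, so a projection with identity maps is a solution. This settles the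
  domains without two distinct elements to separate variables, including the empty one.\<close>

lemma satisfies_subsingleton:
  assumes plc: "pseudo_loop_condition m n P" and cl: "function_clone C \<C>"
    and C: "\<And>x y. x \<in> C \<Longrightarrow> y \<in> C \<Longrightarrow> x = y"
  shows "satisfies C \<C> m n P"
  unfolding satisfies_def satisfies_on_iff[OF plc cl subset_refl]
proof (intro exI[of _ "projection C n 0"] exI[of _ "\<lambda>_. \<lambda>x\<in>C. x"] conjI allI impI)
  have "n > 0"
    using plc by (simp add: pseudo_loop_condition_def)
  then show p: "(n, projection C n 0) \<in> \<C>"
    by (rule clone_projection[OF cl])
  show "(\<lambda>x\<in>C. x) \<in> unary_functions C \<C>"
    by (rule Gr_unary[OF Gr_id[OF cl]])
  show "unary_solution m P C (projection C n 0) (\<lambda>_. \<lambda>x\<in>C. x)"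
    unfolding unary_solution_def
  proof (intro ballI allI impI)
    fix s i j assume s: "s \<in> variables P \<rightarrow> C" and ij: "i < m" "j < m"
    have "projection C n 0 (map s (P ! i)) \<in> C" "projection C n 0 (map s (P ! j)) \<in> C"
      using clone_apply_in[OF cl p map_row_in[OF plc _ s subset_refl]] ij by blast+
    then show "(\<lambda>x\<in>C. x) (projection C n 0 (map s (P ! i))) =
        (\<lambda>x\<in>C. x) (projection C n 0 (map s (P ! j)))"
      using C by simp
  qed
qed

section \<open>Invariant relations of the power clone in coordinates\<close>

lemma componentwise_clone_power:
  assumes "R \<subseteq> nlists m (nlists N C)" "rs \<in> nlists k R"
  shows "componentwise m (restrict (componentwise N f) (nlists k (nlists N C))) rs =
    map (\<lambda>i. map (\<lambda>q. f (map (\<lambda>r. r ! i ! q) rs)) [0..<N]) [0..<m]"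
proof -
  have "map (\<lambda>r. r ! i) rs \<in> nlists k (nlists N C)" if "i < m" for i
    by (rule map_in_nlists[OF assms(2)]) (use assms(1) that nlistsE_nth_in in blast)
  then show ?thesis
    by (simp add: componentwise_def comp_def)
qed

lemma ball_clone_power:
  "(\<forall>(k, g)\<in>clone_power C N \<C>. Q k g) \<longleftrightarrow>
    (\<forall>k f. (k, f) \<in> \<C> \<longrightarrow> Q k (restrict (componentwise N f) (nlists k (nlists N C))))"
    (is "?L \<longleftrightarrow> ?R")
proof
  assume L: ?L
  show ?R
  proof (intro allI impI)
    fix k f assume "(k, f) \<in> \<C>"
    then have "(k, restrict (componentwise N f) (nlists k (nlists N C))) \<in> clone_power C N \<C>"
      unfolding clone_power_def by blast
    from bspec[OF L this] show "Q k (restrict (componentwise N f) (nlists k (nlists N C)))"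
      by simp
  qed
next
  assume R: ?R
  show ?L
  proof (rule ballI)
    fix p assume "p \<in> clone_power C N \<C>"
    then obtain k f where "(k, f) \<in> \<C>" "p = (k, restrict (componentwise N f) (nlists k (nlists N C)))"
      unfolding clone_power_def by blast
    then show "case p of (k, g) \<Rightarrow> Q k g"
      using R by simp
  qed
qed

text \<open>Removes the pairs and restrictions of \<open>clone_power\<close>: in
  \<open>r ! i ! q\<close>, \<open>i\<close> is the position in the tuple of \<open>R\<close> and
  \<open>q\<close> the coordinate in \<open>C^N\<close>, and \<open>f\<close> acts at each pair
  (\<open>i\<close>, \<open>q\<close>) separately.\<close>

lemma preserves_clone_power_iff:
  assumes "R \<subseteq> nlists m (nlists N C)"
  shows "preserves (clone_power C N \<C>) m R \<longleftrightarrow>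
    (\<forall>k f. (k, f) \<in> \<C> \<longrightarrow> (\<forall>rs\<in>nlists k R.
      map (\<lambda>i. map (\<lambda>q. f (map (\<lambda>r. r ! i ! q) rs)) [0..<N]) [0..<m] \<in> R))"
proof -
  have "(\<forall>rs\<in>nlists k R.
        componentwise m (restrict (componentwise N f) (nlists k (nlists N C))) rs \<in> R) \<longleftrightarrow>
      (\<forall>rs\<in>nlists k R.
        map (\<lambda>i. map (\<lambda>q. f (map (\<lambda>r. r ! i ! q) rs)) [0..<N]) [0..<m] \<in> R)" for k f
    by (rule ball_cong[OF refl]) (simp only: componentwise_clone_power[OF assms])
  then show ?thesis
    unfolding preserves_def ball_clone_power by (simp only:)
qed

section \<open>From identities to pseudo-loops\<close>

lemma satisfies_imp_pseudo_loop:
  assumes plc: "pseudo_loop_condition m n P" and cl: "function_clone C \<C>"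
    and core: "core_clone C \<C>" and sat: "satisfies C \<C> m n P"
    and R: "R \<subseteq> nlists m (nlists N C)" "preserves (clone_power C N \<C>) m R"
    and hom: "relation_homomorphism (variables P) (condition_relation n P) (nlists N C) R h"
  shows "\<exists>t. pseudo_loop C \<C> N R t"
proof -
  obtain f u where f: "(n, f) \<in> \<C>" and u: "\<forall>i<m. u i \<in> unary_functions C \<C>"
    and sol: "unary_solution m P C f u"
    using sat unfolding satisfies_def satisfies_on_iff[OF plc cl subset_refl] by (elim exE conjE)
  note eq = unary_solutionD[OF sol]
  have m: "0 < m"
    using plc by (simp add: pseudo_loop_condition_def)
  \<comment> \<open>Each coordinate of \<open>h\<close> is an assignment of the variables in
    \<open>C\<close>, so the identities hold coordinate by coordinate.\<close>
  define s where "s q v = h v ! q" for q v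
  have s: "s q \<in> variables P \<rightarrow> C" if "q < N" for q
  proof
    fix v assume "v \<in> variables P"
    then have "h v \<in> nlists N C"
      using hom unfolding relation_homomorphism_def by blast
    then show "s q v \<in> C"
      unfolding s_def using that by (rule nlistsE_nth_in)
  qed
  \<comment> \<open>The images under \<open>h\<close> of the columns of \<open>P\<close>. Position
    \<open>i\<close> and coordinate \<open>q\<close> read across \<open>rs\<close> give row
    \<open>i\<close> of \<open>P\<close> under \<open>s q\<close>, as \<open>col\<close>
    records.\<close>
  define rs where "rs = map (\<lambda>j. map h (map (\<lambda>row. row ! j) P)) [0..<n]"
  have rs: "rs \<in> nlists n R"
  proof (rule nlistsI)
    have "map h (map (\<lambda>row. row ! j) P) \<in> R" if "j < n" for j
      using hom that unfolding relation_homomorphism_def condition_relation_def by blast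
    then show "set rs \<subseteq> R"
      unfolding rs_def by fastforce
  qed (simp add: rs_def)
  define t where "t i = map (\<lambda>q. f (map (s q) (P ! i))) [0..<N]" for i
  have col: "map (\<lambda>r. r ! i ! q) rs = map (s q) (P ! i)" if "i < m" for i q
  proof (rule nth_equalityI)
    show "length (map (\<lambda>r. r ! i ! q) rs) = length (map (s q) (P ! i))"
      using condition_row(1)[OF plc that] by (simp add: rs_def)
    show "map (\<lambda>r. r ! i ! q) rs ! j = map (s q) (P ! i) ! j"
      if "j < length (map (\<lambda>r. r ! i ! q) rs)" for j
      using that condition_row(1)[OF plc \<open>i < m\<close>] condition_length[OF plc] \<open>i < m\<close>
      by (simp add: rs_def s_def)
  qed
  have "map (\<lambda>i. map (\<lambda>q. f (map (\<lambda>r. r ! i ! q) rs)) [0..<N]) [0..<m] \<in> R"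
    using R(2) f rs unfolding preserves_clone_power_iff[OF R(1)] by blast
  moreover have "map (\<lambda>i. map (\<lambda>q. f (map (\<lambda>r. r ! i ! q) rs)) [0..<N]) [0..<m] = map t [0..<m]"
    by (simp add: t_def col)
  ultimately have tR: "map t [0..<m] \<in> R"
    by simp
  have tC: "t i \<in> nlists N C" if "i < m" for i
  proof (rule nlistsI)
    have "f (map (s q) (P ! i)) \<in> C" if "q < N" for q
      by (rule clone_apply_in[OF cl f map_row_in[OF plc \<open>i < m\<close> s[OF that] subset_refl]])
    then show "set (t i) \<subseteq> C"
      by (auto simp: t_def)
  qed (simp add: t_def)
  \<comment> \<open>By the identities every \<open>u i\<close> sends \<open>t i\<close> to this same
    tuple; index 0 exists because \<open>m\<close> is positive.\<close>
  define w where "w = map (u 0) (t 0)"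
  have w: "w \<in> nlists N C"
    unfolding w_def by (rule map_in_nlists[OF tC[OF m]]) (rule unary_functions_in[OF u[rule_format, OF m]])
  have uw: "map (u i) (t i) = w" if "i < m" for i
    using eq[OF s that m] by (simp add: w_def t_def)
  have "t i \<in> orbit (Gr C \<C>) (tuple_action C N) w" if i: "i < m" for i
  proof -
    \<comment> \<open>The core property replaces \<open>u i\<close> by a group element on the
      finitely many entries of \<open>t i\<close>; its inverse then takes \<open>w\<close> back to
      \<open>t i\<close>.\<close>
    obtain g where g: "g \<in> carrier (Gr C \<C>)" "\<And>x. x \<in> set (t i) \<Longrightarrow> g x = u i x"
      using core_clone_approx[OF core u[rule_format, OF i] finite_set nlistsE_set[OF tC[OF i]]] by metis
    obtain g' where g': "g' \<in> carrier (Gr C \<C>)" "\<And>x. x \<in> C \<Longrightarrow> g' (g x) = x"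
      using Gr_inverse[OF g(1)] by metis
    have "map g' w = map (\<lambda>x. g' (g x)) (t i)"
      unfolding uw[OF i, symmetric] using g(2) by simp
    also have "\<dots> = t i"
      by (rule map_idI) (use g'(2) nlistsE_set[OF tC[OF i]] in blast)
    finally have "t i = map g' w" ..
    then show ?thesis
      unfolding mem_orbit_tuple_action[OF w] using g'(1) by (rule bexI)
  qed
  then have "set (map t [0..<m]) \<subseteq> orbit (Gr C \<C>) (tuple_action C N) w"
    by auto
  moreover have "orbit (Gr C \<C>) (tuple_action C N) w \<in> orbits (Gr C \<C>) (nlists N C) (tuple_action C N)"
    unfolding orbits_def using w by blast
  ultimately show ?thesis
    unfolding pseudo_loop_def using tR by blast
qed

section \<open>From pseudo-loops to local satisfaction\<close>

lemma pseudo_loops_imp_satisfies_on: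
  fixes C :: "'a set"
  assumes plc: "pseudo_loop_condition m n P" and cl: "function_clone C \<C>"
    and F: "finite F" "F \<subseteq> C" and ab: "a \<in> F" "b \<in> F" "a \<noteq> b"
    and loops: "\<forall>N\<ge>1. \<forall>R. R \<subseteq> nlists m (nlists N C) \<and> preserves (clone_power C N \<C>) m R \<longrightarrow>
      (\<exists>h. relation_homomorphism (variables P) (condition_relation n P) (nlists N C) R h \<and>
           inj_on h (variables P)) \<longrightarrow>
      (\<exists>t. pseudo_loop C \<C> N R t)"
  shows "satisfies_on \<C> m n P F"
proof -
  \<comment> \<open>The list fixes an order of the coordinates. Extensional assignments are used so
    that there are finitely many.\<close>
  obtain ss where ss: "set ss = variables P \<rightarrow>\<^sub>E F"
    using finite_list[OF finite_PiE[OF finite_variables[of P] F(1)]] by (elim exE)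
  have ssF: "s \<in> variables P \<rightarrow> F" if "s \<in> set ss" for s
    using that unfolding ss PiE_def by (rule IntD1)
  define N where "N = length ss"
  \<comment> \<open>A constant assignment witnesses that the list is nonempty, as \<open>N\<close>
    must be at least 1.\<close>
  have "(\<lambda>v\<in>variables P. a) \<in> set ss"
    unfolding ss using ab(1) by simp
  then have N: "1 \<le> N"
    unfolding N_def by (cases ss) simp_all
  define h where "h v = map (\<lambda>s. s v) ss" for v
  \<comment> \<open>Row \<open>i\<close> of \<open>T f\<close> is the value table of the term
    \<open>f(x_i)\<close> over all assignments in \<open>ss\<close>.\<close>
  define T where "T f = map (\<lambda>row. map (\<lambda>s. f (map s row)) ss) P" for f :: "'a list \<Rightarrow> 'a"
  define R where "R = T ` {f. (n, f) \<in> \<C>}"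
  have lenP: "length P = m"
    by (rule condition_length[OF plc])
  have arg: "map s (P ! i) \<in> nlists n C" if "s \<in> set ss" "i < m" for s i
    by (rule map_row_in[OF plc that(2) ssF[OF that(1)] F(2)])
  have nthT: "T f ! i = map (\<lambda>s. f (map s (P ! i))) ss" if "i < m" for f i
    using that lenP by (simp add: T_def)
  have T_row: "T f ! i \<in> nlists N C" if "(n, f) \<in> \<C>" "i < m" for f i
  proof (rule nlistsI)
    have "f (map s (P ! i)) \<in> C" if "s \<in> set ss" for s
      by (rule clone_apply_in[OF cl \<open>(n, f) \<in> \<C>\<close> arg[OF that \<open>i < m\<close>]])
    then show "set (T f ! i) \<subseteq> C"
      unfolding nthT[OF that(2)] set_map by (rule image_subsetI)
  qed (simp add: nthT[OF that(2)] N_def)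
  have R_sub: "R \<subseteq> nlists m (nlists N C)"
  proof
    fix r assume "r \<in> R"
    then obtain f where f: "(n, f) \<in> \<C>" "r = T f"
      unfolding R_def by blast
    show "r \<in> nlists m (nlists N C)"
    proof (rule nlistsI)
      show len: "length r = m"
        by (simp add: f(2) T_def lenP)
      show "set r \<subseteq> nlists N C"
      proof
        fix x assume "x \<in> set r"
        then obtain i where "i < m" "x = r ! i"
          unfolding in_set_conv_nth len by blast
        then show "x \<in> nlists N C"
          using T_row[OF f(1)] f(2) by simp
      qed
    qed
  qed
  have "preserves (clone_power C N \<C>) m R"
    unfolding preserves_clone_power_iff[OF R_sub]
  proof (intro allI impI ballI)
    fix k g rs assume g: "(k, g) \<in> \<C>" and rs: "rs \<in> nlists k R"
    \<comment> \<open>Each tuple in \<open>rs\<close> is the table of some clone operation; one is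
      chosen for each. Applying \<open>g\<close> to the tables gives the table of the composition of
      \<open>g\<close> with these operations.\<close>
    define fs where "fs = map (inv_into {f. (n, f) \<in> \<C>} T) rs"
    have rsR: "r \<in> T ` {f. (n, f) \<in> \<C>}" if "r \<in> set rs" for r
      using nlistsE_set[OF rs] that unfolding R_def by blast
    have fs: "(n, f) \<in> \<C>" if f: "f \<in> set fs" for f
    proof -
      obtain r where r: "r \<in> set rs" "f = inv_into {f. (n, f) \<in> \<C>} T r"
        using f unfolding fs_def set_map by blast
      show ?thesis
        using inv_into_into[OF rsR[OF r(1)]] unfolding r(2) by simp
    qed
    have "map T fs = rs"
      unfolding fs_def map_map by (rule map_idI) (simp only: comp_def f_inv_into_f[OF rsR])
    then have rs_eq: "rs = map T fs" ..
    have "length fs = k"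
      using nlistsE_length[OF rs] by (simp add: fs_def)
    then have comp: "(n, composition C n g fs) \<in> \<C>"
      using fs by (intro clone_composition[OF cl g])
    have "map (\<lambda>i. map (\<lambda>q. g (map (\<lambda>r. r ! i ! q) rs)) [0..<N]) [0..<m] = T (composition C n g fs)"
    proof (rule nth_equalityI)
      fix i assume "i < length (map (\<lambda>i. map (\<lambda>q. g (map (\<lambda>r. r ! i ! q) rs)) [0..<N]) [0..<m])"
      then have i: "i < m"
        by simp
      have "map (\<lambda>q. g (map (\<lambda>r. r ! i ! q) rs)) [0..<N] = T (composition C n g fs) ! i"
      proof (rule nth_equalityI)
        fix q assume "q < length (map (\<lambda>q. g (map (\<lambda>r. r ! i ! q) rs)) [0..<N])"
        then have q: "q < length ss"
          by (simp add: N_def)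
        have "map (\<lambda>r. r ! i ! q) rs = map (\<lambda>f. f (map (ss ! q) (P ! i))) fs"
          unfolding rs_eq using q by (simp add: nthT[OF i] comp_def)
        then show "map (\<lambda>q. g (map (\<lambda>r. r ! i ! q) rs)) [0..<N] ! q = T (composition C n g fs) ! i ! q"
          using q arg[OF nth_mem[OF q] i] by (simp add: nthT[OF i] N_def composition_def)
      qed (simp add: nthT[OF i] N_def)
      then show "map (\<lambda>i. map (\<lambda>q. g (map (\<lambda>r. r ! i ! q) rs)) [0..<N]) [0..<m] ! i =
          T (composition C n g fs) ! i"
        using i by simp
    qed (simp add: T_def lenP)
    then show "map (\<lambda>i. map (\<lambda>q. g (map (\<lambda>r. r ! i ! q) rs)) [0..<N]) [0..<m] \<in> R"
      unfolding R_def using comp by simp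
  qed
  moreover have "relation_homomorphism (variables P) (condition_relation n P) (nlists N C) R h"
    unfolding relation_homomorphism_def
  proof (intro conjI ballI)
    show "h \<in> variables P \<rightarrow> nlists N C"
    proof
      fix v assume v: "v \<in> variables P"
      have "s v \<in> C" if "s \<in> set ss" for s
        using funcset_mem[OF ssF[OF that] v] F(2) by blast
      then show "h v \<in> nlists N C"
        unfolding h_def N_def nlists_map by (rule image_subsetI)
    qed
    fix c assume "c \<in> condition_relation n P"
    then obtain j where j: "j < n" "c = map (\<lambda>row. row ! j) P"
      unfolding condition_relation_def by blast
    \<comment> \<open>Evaluation at the entries of column \<open>j\<close> is what the
      \<open>j\<close>-th projection computes, so the generators of \<open>R\<close> are the tables
      of projections.\<close>
    have "map h c = T (projection C n j)"
    proof (rule nth_equalityI)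
      fix i assume "i < length (map h c)"
      then have i: "i < m"
        by (simp add: j(2) lenP)
      have "h (P ! i ! j) = map (\<lambda>s. projection C n j (map s (P ! i))) ss"
        unfolding h_def
      proof (rule map_cong[OF refl])
        fix s assume "s \<in> set ss"
        then show "s (P ! i ! j) = projection C n j (map s (P ! i))"
          using arg i j(1) condition_row(1)[OF plc i] by (simp add: projection_def)
      qed
      then show "map h c ! i = T (projection C n j) ! i"
        using i lenP by (simp add: nthT[OF i] j(2))
    qed (simp add: j(2) T_def)
    then show "map h c \<in> R"
      unfolding R_def using clone_projection[OF cl j(1)] by simp
  qed
  moreover have "inj_on h (variables P)"
  proof (rule inj_onI, rule ccontr)
    fix v w assume vw: "v \<in> variables P" "w \<in> variables P" "h v = h w" "v \<noteq> w"
    \<comment> \<open>This assignment is one of the coordinates and separates \<open>v\<close> from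
      \<open>w\<close>, because \<open>a\<close> and \<open>b\<close> differ.\<close>
    define s where "s = (\<lambda>x\<in>variables P. if x = v then a else b)"
    have "s \<in> set ss"
      unfolding ss s_def using ab by simp
    then have "s v = s w"
      using vw(3) unfolding h_def by simp
    then show False
      using vw ab(3) by (simp add: s_def)
  qed
  ultimately obtain t where t: "pseudo_loop C \<C> N R t"
    using loops N R_sub by blast
  then obtain f where f: "(n, f) \<in> \<C>" "t = T f"
    unfolding pseudo_loop_def R_def by blast
  obtain \<Omega> where "\<Omega> \<in> orbits (Gr C \<C>) (nlists N C) (tuple_action C N)" "set t \<subseteq> \<Omega>"
    using t unfolding pseudo_loop_def by blast
  then obtain x where x: "x \<in> nlists N C" "set t \<subseteq> orbit (Gr C \<C>) (tuple_action C N) x"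
    unfolding orbits_def by blast
  \<comment> \<open>The unary functions are the inverses of the group elements that reach the rows
    of the pseudo-loop from the common point \<open>x\<close> of the orbit.\<close>
  have "\<exists>u\<in>unary_functions C \<C>. map u (T f ! i) = x" if i: "i < m" for i
  proof -
    have "T f ! i \<in> set t"
      unfolding f(2) by (rule nth_mem) (simp add: T_def lenP i)
    then obtain g where g: "g \<in> carrier (Gr C \<C>)" "T f ! i = map g x"
      using x(2) mem_orbit_tuple_action[OF x(1)] by blast
    obtain g' where g': "g' \<in> carrier (Gr C \<C>)" "\<And>y. y \<in> C \<Longrightarrow> g' (g y) = y"
      using Gr_inverse[OF g(1)] by metis
    have "map g' (T f ! i) = x"
      unfolding g(2) map_map comp_def
      by (rule map_idI) (use g'(2) nlistsE_set[OF x(1)] in blast)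
    then show ?thesis
      using Gr_unary[OF g'(1)] by (rule bexI)
  qed
  then obtain u where u: "\<And>i. i < m \<Longrightarrow> u i \<in> unary_functions C \<C>"
    "\<And>i. i < m \<Longrightarrow> map (u i) (T f ! i) = x"
    by metis
  have "unary_solution m P F f u"
    unfolding unary_solution_def
  proof (intro ballI allI impI)
    fix s i j assume s: "s \<in> variables P \<rightarrow> F" and ij: "i < m" "j < m"
    \<comment> \<open>Only values on the variables matter, so an arbitrary assignment is replaced by
      its extensional version, which occurs in \<open>ss\<close>.\<close>
    define s' where "s' = restrict s (variables P)"
    have "s' \<in> set ss"
      unfolding ss s'_def restrict_PiE_iff using s by blast
    moreover have "map s' (P ! l) = map s (P ! l)" if "l < m" for l
      using condition_row(2)[OF plc that] by (intro map_cong[OF refl]) (auto simp: s'_def)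
    moreover have "map (\<lambda>s. u i (f (map s (P ! i)))) ss = map (\<lambda>s. u j (f (map s (P ! j)))) ss"
      using u(2)[OF ij(1)] u(2)[OF ij(2)] by (simp add: nthT[OF ij(1)] nthT[OF ij(2)] comp_def)
    then have "\<forall>s\<in>set ss. u i (f (map s (P ! i))) = u j (f (map s (P ! j)))"
      unfolding map_eq_conv .
    ultimately show "u i (f (map s (P ! i))) = u j (f (map s (P ! j)))"
      using ij by metis
  qed
  then show ?thesis
    unfolding satisfies_on_iff[OF plc cl F(2)] using f(1) u(1) by blast
qed

section \<open>From local to global satisfaction\<close>

lemma finite_nlists: "finite A \<Longrightarrow> finite (nlists k A)"
  by (induction k) (simp_all add: nlists_Suc)

lemma countable_nlists: "countable A \<Longrightarrow> countable (nlists k A)"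
  by (induction k) (simp_all add: nlists_Suc)

lemma unary_solution_mono:
  assumes "unary_solution m P G f u" "F \<subseteq> G"
  shows "unary_solution m P F f u"
proof -
  have FG: "variables P \<rightarrow> F \<subseteq> variables P \<rightarrow> G"
    by (rule Pi_mono) (rule assms(2))
  show ?thesis
    unfolding unary_solution_def
    by (rule ballI) (rule bspec[OF assms(1)[unfolded unary_solution_def] subsetD[OF FG]])
qed

lemma unary_solution_cong:
  assumes plc: "pseudo_loop_condition m n P" and sol: "unary_solution m P F f u"
    and fg: "\<And>xs. xs \<in> nlists n F \<Longrightarrow> g xs = f xs"
  shows "unary_solution m P F g u"
  unfolding unary_solution_def
proof (intro ballI allI impI)
  fix s i j assume s: "s \<in> variables P \<rightarrow> F" and ij: "i < m" "j < m"
  have "g (map s (P ! k)) = f (map s (P ! k))" if "k < m" for k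
    by (rule fg[OF map_row_in[OF plc that s subset_refl]])
  then show "u i (g (map s (P ! i))) = u j (g (map s (P ! j)))"
    using unary_solutionD[OF sol s ij] ij by simp
qed

text \<open>Compactness is applied to \<open>f\<close> alone, with \<open>u\<close> existentially
  quantified at each stage: \<open>u\<close> has to change when a group element is applied to
  \<open>f\<close>, and may still depend on the stage afterwards.\<close>

lemma satisfies_locally_common_operation:
  fixes F :: "nat \<Rightarrow> 'a set"
  assumes plc: "pseudo_loop_condition m n P" and cl: "function_clone C \<C>"
    and "closed_clone C \<C>" and ol: "oligomorphic C \<C>" and "countable C" "C \<noteq> {}"
    and F: "mono F" "\<And>l. finite (F l)" "\<And>l. F l \<subseteq> C"
    and loc: "satisfies_locally C \<C> m n P"
  obtains f where "(n, f) \<in> \<C>"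
    "\<And>l. \<exists>u. (\<forall>i<m. u i \<in> unary_functions C \<C>) \<and> unary_solution m P (F l) f u"
proof -
  define S where "S l = {f. (n, f) \<in> \<C> \<and>
    (\<exists>u. (\<forall>i<m. u i \<in> unary_functions C \<C>) \<and> unary_solution m P (F l) f u)}" for l
  have n: "1 \<le> n"
    using plc unfolding pseudo_loop_condition_def by (elim conjE)
  have I: "countable (nlists n C)" "nlists n C \<noteq> {}"
    using countable_nlists[OF \<open>countable C\<close>] nlists_not_empty[OF \<open>C \<noteq> {}\<close>, of n]
    unfolding ex_in_conv by this+
  have S_fun: "S l \<subseteq> nlists n C \<rightarrow> C" for l
  proof
    fix f assume "f \<in> S l"
    then have "(n, f) \<in> \<C>"
      unfolding S_def mem_Collect_eq by (rule conjunct1)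
    then show "f \<in> nlists n C \<rightarrow> C"
      using clone_apply_in[OF cl] by (intro funcsetI)
  qed
  have S_ne: "S l \<noteq> {}" for l
  proof -
    have "satisfies_on \<C> m n P (F l)"
      using loc F(2,3) unfolding satisfies_locally_def by simp
    then have "\<exists>f. f \<in> S l"
      unfolding satisfies_on_iff[OF plc cl F(3)] S_def mem_Collect_eq
      by (elim exE conjE) (intro exI conjI)
    then show ?thesis
      unfolding ex_in_conv .
  qed
  have S_mono: "antimono S"
  proof (rule antimonoI)
    fix l l' :: nat assume "l \<le> l'"
    then have FF: "F l \<subseteq> F l'"
      by (rule monoD[OF F(1)])
    show "S l' \<subseteq> S l"
      unfolding S_def
      by (intro Collect_mono impI, elim conjE exE, intro conjI exI)
        (assumption | rule unary_solution_mono[OF _ FF])+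
  qed
  have S_inv: "(\<lambda>xs\<in>nlists n C. g (f xs)) \<in> S l" if f: "f \<in> S l" and g: "g \<in> carrier (Gr C \<C>)"
    for l f g
  proof -
    obtain g' where g': "g' \<in> carrier (Gr C \<C>)" "\<And>x. x \<in> C \<Longrightarrow> g' (g x) = x"
      using Gr_inverse[OF g] by metis
    obtain u where fC: "(n, f) \<in> \<C>" and u: "\<forall>i<m. u i \<in> unary_functions C \<C>"
      and sol: "unary_solution m P (F l) f u"
      using f unfolding S_def mem_Collect_eq by (elim conjE exE)
    \<comment> \<open>Precomposing every \<open>u i\<close> with the inverse \<open>g'\<close>
      cancels the new factor \<open>g\<close>.\<close>
    have "unary_solution m P (F l) (\<lambda>xs\<in>nlists n C. g (f xs)) (\<lambda>i. \<lambda>x\<in>C. u i (g' x))"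
      unfolding unary_solution_def
    proof (intro ballI allI impI)
      fix s i j assume s: "s \<in> variables P \<rightarrow> F l" and ij: "i < m" "j < m"
      have "(\<lambda>x\<in>C. u k (g' x)) ((\<lambda>xs\<in>nlists n C. g (f xs)) (map s (P ! k))) = u k (f (map s (P ! k)))"
        if "k < m" for k
      proof -
        have row: "map s (P ! k) \<in> nlists n C"
          by (rule map_row_in[OF plc that s F(3)])
        have fx: "f (map s (P ! k)) \<in> C"
          by (rule clone_apply_in[OF cl fC row])
        then have "g (f (map s (P ! k))) \<in> C"
          by (rule unary_functions_in[OF Gr_unary[OF g]])
        then show ?thesis
          using row fx by (simp add: g'(2))
      qed
      then show "(\<lambda>x\<in>C. u i (g' x)) ((\<lambda>xs\<in>nlists n C. g (f xs)) (map s (P ! i))) =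
          (\<lambda>x\<in>C. u j (g' x)) ((\<lambda>xs\<in>nlists n C. g (f xs)) (map s (P ! j)))"
        using unary_solutionD[OF sol s ij] ij by simp
    qed
    moreover have "(\<lambda>x\<in>C. u i (g' x)) \<in> unary_functions C \<C>" if "i < m" for i
      by (rule unary_functions_compose[OF cl u[rule_format, OF that] Gr_unary[OF g'(1)]])
    moreover have "(n, \<lambda>xs\<in>nlists n C. g (f xs)) \<in> \<C>"
      by (rule clone_unary_compose[OF cl Gr_unary[OF g] fC])
    ultimately show ?thesis
      unfolding S_def mem_Collect_eq
      by (intro conjI exI[of _ "\<lambda>i. \<lambda>x\<in>C. u i (g' x)"] allI impI)
  qed
  have "\<exists>\<phi>\<in>nlists n C \<rightarrow>\<^sub>E C.
      \<forall>l J. finite J \<longrightarrow> J \<subseteq> nlists n C \<longrightarrow> (\<exists>\<psi>\<in>S l. \<forall>x\<in>J. \<psi> x = \<phi> x)"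
  proof (rule oligomorphic_compactness[OF cl ol I S_fun S_ne S_mono])
    show "(\<lambda>x\<in>nlists n C. g (\<psi> x)) \<in> S l" if "\<psi> \<in> S l" "g \<in> carrier (Gr C \<C>)" for l \<psi> g
      by (rule S_inv[OF that])
  qed
  then obtain \<phi> where \<phi>: "\<phi> \<in> nlists n C \<rightarrow>\<^sub>E C"
    and lim: "\<forall>l J. finite J \<longrightarrow> J \<subseteq> nlists n C \<longrightarrow> (\<exists>\<psi>\<in>S l. \<forall>x\<in>J. \<psi> x = \<phi> x)"
    by (elim bexE)
  note approx = lim[rule_format]
  have "\<exists>g. (n, g) \<in> \<C> \<and> (\<forall>x\<in>J. g x = \<phi> x)" if J: "finite J" "J \<subseteq> nlists n C" for J
  proof -
    obtain \<psi> where "\<psi> \<in> S 0" "\<forall>x\<in>J. \<psi> x = \<phi> x"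
      using approx[OF J, where l=0] by (elim bexE)
    then show ?thesis
      unfolding S_def mem_Collect_eq by (intro exI[of _ \<psi>]) (elim conjE, intro conjI)
  qed
  then have "(n, \<phi>) \<in> \<C>"
    by (rule closed_clone_limit[OF \<open>closed_clone C \<C>\<close> n \<phi>])
  moreover have "\<exists>u. (\<forall>i<m. u i \<in> unary_functions C \<C>) \<and> unary_solution m P (F l) \<phi> u" for l
  proof -
    \<comment> \<open>There are finitely many argument lists over \<open>F l\<close>. An approximant
      agreeing with \<open>\<phi>\<close> on all of them passes its unary functions on to
      \<open>\<phi>\<close>.\<close>
    obtain \<psi> where \<psi>: "\<psi> \<in> S l" "\<forall>xs\<in>nlists n (F l). \<psi> xs = \<phi> xs"
      using approx[OF finite_nlists[OF F(2)] nlists_mono[OF F(3)], where l=l, of l] by (elim bexE)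
    obtain u where u: "\<forall>i<m. u i \<in> unary_functions C \<C>" "unary_solution m P (F l) \<psi> u"
      using \<psi>(1) unfolding S_def mem_Collect_eq by (elim conjE exE)
    have "unary_solution m P (F l) \<phi> u"
      by (rule unary_solution_cong[OF plc u(2)]) (use \<psi>(2) in simp)
    then show ?thesis
      using u(1) by (intro exI[of _ u] conjI)
  qed
  ultimately show ?thesis
    by (rule that)
qed

text \<open>With \<open>f\<close> fixed, applying one group element on the left of all
  \<open>u i\<close> keeps every identity. Hence the whole family is treated as a single point of
  the compactness argument.\<close>

lemma common_operation_imp_satisfies:
  fixes F :: "nat \<Rightarrow> 'a set"
  assumes plc: "pseudo_loop_condition m n P" and cl: "function_clone C \<C>"
    and "closed_clone C \<C>" and ol: "oligomorphic C \<C>" and "countable C" "C \<noteq> {}"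
    and F: "mono F" "\<And>l. F l \<subseteq> C" "\<And>J. finite J \<Longrightarrow> J \<subseteq> C \<Longrightarrow> \<exists>l. J \<subseteq> F l"
    and f: "(n, f) \<in> \<C>"
    and loc: "\<And>l. \<exists>u. (\<forall>i<m. u i \<in> unary_functions C \<C>) \<and> unary_solution m P (F l) f u"
  shows "satisfies C \<C> m n P"
proof -
  \<comment> \<open>A family of \<open>m\<close> unary functions becomes one function on pairs, so
    that the same \<open>g\<close> acts on all members. Elements of \<open>S l\<close> need not be
    extensional, hence the slices are restricted to \<open>C\<close>.\<close>
  define I where "I = {..<m} \<times> C"
  define S where "S l = {w \<in> I \<rightarrow> C. (\<forall>i<m. (\<lambda>x\<in>C. w (i, x)) \<in> unary_functions C \<C>) \<and>
    unary_solution m P (F l) f (\<lambda>i x. w (i, x))}" for l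
  have m: "0 < m"
    using plc by (simp add: pseudo_loop_condition_def)
  have I: "countable I" "I \<noteq> {}"
    using m \<open>countable C\<close> \<open>C \<noteq> {}\<close> by (auto simp: I_def)
  have S_fun: "S l \<subseteq> I \<rightarrow> C" for l
    unfolding S_def by (rule Collect_restrict)
  have S_ne: "S l \<noteq> {}" for l
  proof -
    obtain u where u: "\<forall>i<m. u i \<in> unary_functions C \<C>" "unary_solution m P (F l) f u"
      using loc[of l] by (elim exE conjE)
    have "(\<lambda>x\<in>C. u i x) = u i" if "i < m" for i
      using u(1) that PiE_restrict[of "u i" C "\<lambda>_. C"] by (simp add: unary_functions_def)
    moreover have "(\<lambda>(i, x). u i x) \<in> I \<rightarrow> C"
    proof (rule funcsetI)
      fix p assume "p \<in> I"
      then obtain i x where p: "p = (i, x)" "i < m" "x \<in> C"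
        unfolding I_def by blast
      then show "(case p of (i, x) \<Rightarrow> u i x) \<in> C"
        using unary_functions_in[OF u(1)[rule_format, OF p(2)] p(3)] by (simp add: p(1))
    qed
    ultimately have "(\<lambda>(i, x). u i x) \<in> S l"
      using u by (simp add: S_def)
    then show ?thesis
      by blast
  qed
  have S_mono: "antimono S"
  proof (rule antimonoI)
    fix l l' :: nat assume "l \<le> l'"
    then have FF: "F l \<subseteq> F l'"
      by (rule monoD[OF F(1)])
    show "S l' \<subseteq> S l"
      unfolding S_def
      by (intro Collect_mono impI, elim conjE, intro conjI)
        (assumption | rule unary_solution_mono[OF _ FF])+
  qed
  have row: "f (map s (P ! i)) \<in> C" if "s \<in> variables P \<rightarrow> F l" "i < m" for s i l
    by (rule clone_apply_in[OF cl f map_row_in[OF plc that(2,1) F(2)]])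
  have S_inv: "(\<lambda>x\<in>I. g (w x)) \<in> S l" if w: "w \<in> S l" and g: "g \<in> carrier (Gr C \<C>)" for l w g
  proof -
    have wI: "w \<in> I \<rightarrow> C" and wU: "\<forall>i<m. (\<lambda>x\<in>C. w (i, x)) \<in> unary_functions C \<C>"
      and sol: "unary_solution m P (F l) f (\<lambda>i x. w (i, x))"
      using w unfolding S_def by simp_all
    have gI: "(\<lambda>x\<in>I. g (w x)) \<in> I \<rightarrow> C"
      using funcset_mem[OF wI] unary_functions_in[OF Gr_unary[OF g]] by (intro funcsetI) simp
    have gU: "(\<lambda>x\<in>C. (\<lambda>x\<in>I. g (w x)) (i, x)) \<in> unary_functions C \<C>" if "i < m" for i
    proof -
      have "(\<lambda>x\<in>C. (\<lambda>x\<in>I. g (w x)) (i, x)) = (\<lambda>x\<in>C. g ((\<lambda>x\<in>C. w (i, x)) x))"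
        by (rule restrict_ext) (simp add: I_def that)
      then show ?thesis
        using unary_functions_compose[OF cl Gr_unary[OF g] wU[rule_format, OF that]] by (simp only:)
    qed
    have "unary_solution m P (F l) f (\<lambda>i x. (\<lambda>x\<in>I. g (w x)) (i, x))"
      unfolding unary_solution_def
    proof (intro ballI allI impI)
      fix s i j assume s: "s \<in> variables P \<rightarrow> F l" and ij: "i < m" "j < m"
      then have "w (i, f (map s (P ! i))) = w (j, f (map s (P ! j)))"
        by (intro unary_solutionD[OF sol])
      then show "(\<lambda>x\<in>I. g (w x)) (i, f (map s (P ! i))) = (\<lambda>x\<in>I. g (w x)) (j, f (map s (P ! j)))"
        using row[OF s] ij by (simp add: I_def)
    qed
    then show ?thesis
      unfolding S_def using gI gU by simp
  qed
  have "\<exists>\<omega>\<in>I \<rightarrow>\<^sub>E C.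
      \<forall>l J. finite J \<longrightarrow> J \<subseteq> I \<longrightarrow> (\<exists>w\<in>S l. \<forall>x\<in>J. w x = \<omega> x)"
  proof (rule oligomorphic_compactness[OF cl ol I S_fun S_ne S_mono])
    show "(\<lambda>x\<in>I. g (w x)) \<in> S l" if "w \<in> S l" "g \<in> carrier (Gr C \<C>)" for l w g
      by (rule S_inv[OF that])
  qed
  then obtain \<omega> where \<omega>: "\<omega> \<in> I \<rightarrow>\<^sub>E C"
    and lim: "\<forall>l J. finite J \<longrightarrow> J \<subseteq> I \<longrightarrow> (\<exists>w\<in>S l. \<forall>x\<in>J. w x = \<omega> x)"
    by (elim bexE)
  note approx = lim[rule_format]
  have "(\<lambda>x\<in>C. \<omega> (i, x)) \<in> unary_functions C \<C>" if i: "i < m" for i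
  proof -
    have \<omega>C: "\<omega> (i, x) \<in> C" if "x \<in> C" for x
      by (rule PiE_mem[OF \<omega>]) (simp add: I_def i that)
    have hd_in: "hd xs \<in> C" if "xs \<in> nlists 1 C" for xs
      using that by (auto simp: in_nlists_Suc_iff)
    have "(1, \<lambda>xs\<in>nlists 1 C. \<omega> (i, hd xs)) \<in> \<C>"
    proof (rule closed_clone_limit[OF \<open>closed_clone C \<C>\<close> order_refl])
      show "(\<lambda>xs\<in>nlists 1 C. \<omega> (i, hd xs)) \<in> nlists 1 C \<rightarrow>\<^sub>E C"
        unfolding restrict_PiE_iff using \<omega>C hd_in by blast
      fix J assume J: "finite J" "J \<subseteq> nlists 1 C"
      have JI: "(\<lambda>xs. (i, hd xs)) ` J \<subseteq> I"
        using J(2) hd_in i by (auto simp: I_def)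
      \<comment> \<open>Stage 0 is enough here: only membership of the slices in the clone is used,
        and closedness passes it on to the limit.\<close>
      obtain w where w: "w \<in> S 0" "\<forall>x\<in>(\<lambda>xs. (i, hd xs)) ` J. w x = \<omega> x"
        using approx[OF finite_imageI[OF J(1)] JI, of 0] by (elim bexE)
      have "(1, \<lambda>xs\<in>nlists 1 C. (\<lambda>x\<in>C. w (i, x)) (hd xs)) \<in> \<C>"
        using w(1) i unfolding S_def unary_functions_def by simp
      moreover have "(\<lambda>xs\<in>nlists 1 C. (\<lambda>x\<in>C. w (i, x)) (hd xs)) xs =
          (\<lambda>xs\<in>nlists 1 C. \<omega> (i, hd xs)) xs" if "xs \<in> J" for xs
      proof -
        have "xs \<in> nlists 1 C"
          using J(2) that by (rule subsetD)
        then show ?thesis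
          using w(2) that hd_in by simp
      qed
      ultimately show "\<exists>g. (1, g) \<in> \<C> \<and> (\<forall>xs\<in>J. g xs = (\<lambda>xs\<in>nlists 1 C. \<omega> (i, hd xs)) xs)"
        by (intro exI conjI ballI)
    qed
    moreover have "(\<lambda>xs\<in>nlists 1 C. (\<lambda>x\<in>C. \<omega> (i, x)) (hd xs)) = (\<lambda>xs\<in>nlists 1 C. \<omega> (i, hd xs))"
      by (rule restrict_ext) (simp add: hd_in)
    ultimately show ?thesis
      unfolding unary_functions_def using \<omega>C by simp
  qed
  moreover have "unary_solution m P C f (\<lambda>i. \<lambda>x\<in>C. \<omega> (i, x))"
    unfolding unary_solution_def
  proof (intro ballI allI impI)
    fix s i j assume s: "s \<in> variables P \<rightarrow> C" and ij: "i < m" "j < m"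
    \<comment> \<open>An assignment takes finitely many values, so it already lives in some
      \<open>F l\<close>.\<close>
    have "s ` variables P \<subseteq> C"
      using s by (rule funcset_image)
    then obtain l where "s ` variables P \<subseteq> F l"
      using F(3)[OF finite_imageI[OF finite_variables]] by blast
    then have sl: "s \<in> variables P \<rightarrow> F l"
      unfolding image_subset_iff_funcset .
    have x: "f (map s (P ! i)) \<in> C" "f (map s (P ! j)) \<in> C"
      using row[OF sl] ij by simp_all
    \<comment> \<open>One identity involves just two points of \<open>I\<close>; an approximant from
      stage \<open>l\<close> that agrees with the limit at both transfers it.\<close>
    obtain w where w: "w \<in> S l"
      "\<forall>x\<in>{(i, f (map s (P ! i))), (j, f (map s (P ! j)))}. w x = \<omega> x"
      using approx[where J="{(i, f (map s (P ! i))), (j, f (map s (P ! j)))}" and l=l] x ij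
      by (auto simp: I_def)
    have "w (i, f (map s (P ! i))) = w (j, f (map s (P ! j)))"
    proof (rule unary_solutionD[OF _ sl ij])
      show "unary_solution m P (F l) f (\<lambda>i x. w (i, x))"
        using w(1) unfolding S_def by simp
    qed
    then show "(\<lambda>x\<in>C. \<omega> (i, x)) (f (map s (P ! i))) = (\<lambda>x\<in>C. \<omega> (j, x)) (f (map s (P ! j)))"
      using x w(2) by simp
  qed
  ultimately show ?thesis
    unfolding satisfies_def satisfies_on_iff[OF plc cl subset_refl]
    using f by (intro exI[of _ f] exI[of _ "\<lambda>i. \<lambda>x\<in>C. \<omega> (i, x)"] conjI allI impI)
qed

lemma countable_finite_exhaustion:
  fixes C :: "'a set"
  assumes "countable C" "C \<noteq> {}"
  obtains F :: "nat \<Rightarrow> 'a set" where "mono F" "\<And>l. finite (F l)" "\<And>l. F l \<subseteq> C"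
    "\<And>J. finite J \<Longrightarrow> J \<subseteq> C \<Longrightarrow> \<exists>l. J \<subseteq> F l"
proof
  let ?F = "\<lambda>l. from_nat_into C ` {..<l}"
  show "mono ?F"
    by (rule monoI) (simp add: image_mono)
  show "finite (?F l)" for l
    by simp
  show "?F l \<subseteq> C" for l
    using from_nat_into[OF assms(2)] by blast
  fix J assume J: "finite J" "J \<subseteq> C"
  obtain l where l: "to_nat_on C ` J \<subseteq> {..<l}"
    using finite_nat_iff_bounded[of "to_nat_on C ` J"] finite_imageI[OF J(1)] by blast
  have "x \<in> ?F l" if "x \<in> J" for x
  proof (rule image_eqI)
    show "x = from_nat_into C (to_nat_on C x)"
      using assms J(2) that by (simp add: subsetD)
    show "to_nat_on C x \<in> {..<l}"
      using l that by blast
  qed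
  then show "\<exists>l. J \<subseteq> ?F l"
    by blast
qed

lemma satisfies_locally_imp_satisfies:
  fixes C :: "'a set"
  assumes plc: "pseudo_loop_condition m n P" and "countable C" and cl: "function_clone C \<C>"
    and closed: "closed_clone C \<C>" and ol: "oligomorphic C \<C>"
    and loc: "satisfies_locally C \<C> m n P"
  shows "satisfies C \<C> m n P"
proof (cases "C = {}")
  case True
  then show ?thesis
    by (intro satisfies_subsingleton[OF plc cl]) simp
next
  case False
  obtain F :: "nat \<Rightarrow> 'a set" where F: "mono F" "\<And>l. finite (F l)" "\<And>l. F l \<subseteq> C"
    "\<And>J. finite J \<Longrightarrow> J \<subseteq> C \<Longrightarrow> \<exists>l. J \<subseteq> F l"
    by (rule countable_finite_exhaustion[OF \<open>countable C\<close> False]) blast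
  obtain f where f: "(n, f) \<in> \<C>"
    "\<And>l. \<exists>u. (\<forall>i<m. u i \<in> unary_functions C \<C>) \<and> unary_solution m P (F l) f u"
    by (rule satisfies_locally_common_operation[OF plc cl closed ol \<open>countable C\<close> False F(1-3) loc]) blast
  show ?thesis
    by (rule common_operation_imp_satisfies[OF plc cl closed ol \<open>countable C\<close> False F(1,3,4) f])
qed

section \<open>The cycle of implications between the four conditions\<close>

theorem proposition4p2:
  fixes C :: "'a set"
    and \<C> :: "(nat \<times> ('a list \<Rightarrow> 'a)) set"
    and P :: "'v list list"
    and m n :: nat
  assumes "pseudo_loop_condition m n P"
    and "countable C"
    and "function_clone C \<C>"
    and "closed_clone C \<C>"
    and "oligomorphic C \<C>"
    and "core_clone C \<C>"
  shows
    "(satisfies_locally C \<C> m n P \<longleftrightarrow> satisfies C \<C> m n P) \<and>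
     (satisfies C \<C> m n P \<longleftrightarrow>
        (\<forall>N\<ge>1. \<forall>R. R \<subseteq> nlists m (nlists N C) \<and> preserves (clone_power C N \<C>) m R \<longrightarrow>
            (\<exists>h. relation_homomorphism (variables P) (condition_relation n P) (nlists N C) R h) \<longrightarrow>
            (\<exists>t. pseudo_loop C \<C> N R t))) \<and>
     (satisfies C \<C> m n P \<longleftrightarrow>
        (\<forall>N\<ge>1. \<forall>R. R \<subseteq> nlists m (nlists N C) \<and> preserves (clone_power C N \<C>) m R \<longrightarrow>
            (\<exists>h. relation_homomorphism (variables P) (condition_relation n P) (nlists N C) R h \<and>
                 inj_on h (variables P)) \<longrightarrow>
            (\<exists>t. pseudo_loop C \<C> N R t)))"
proof -
  let ?loops = "\<lambda>N R. \<exists>t. pseudo_loop C \<C> N R t"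
  let ?hom = "relation_homomorphism (variables P) (condition_relation n P)"
  let ?c = "\<forall>N\<ge>1. \<forall>R. R \<subseteq> nlists m (nlists N C) \<and> preserves (clone_power C N \<C>) m R \<longrightarrow>
    (\<exists>h. ?hom (nlists N C) R h) \<longrightarrow> ?loops N R"
  let ?d = "\<forall>N\<ge>1. \<forall>R. R \<subseteq> nlists m (nlists N C) \<and> preserves (clone_power C N \<C>) m R \<longrightarrow>
    (\<exists>h. ?hom (nlists N C) R h \<and> inj_on h (variables P)) \<longrightarrow> ?loops N R"
  note plc = assms(1) and cl = assms(3)
  have ba: "satisfies_locally C \<C> m n P" if "satisfies C \<C> m n P"
    unfolding satisfies_locally_def
  proof (intro allI impI, elim conjE)
    fix F assume "F \<subseteq> C"
    then show "satisfies_on \<C> m n P F"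
      by (rule satisfies_on_mono[OF that[unfolded satisfies_def]])
  qed
  have ab: "satisfies C \<C> m n P" if "satisfies_locally C \<C> m n P"
    by (rule satisfies_locally_imp_satisfies[OF plc assms(2) cl assms(4,5) that])
  have bc: ?c if sat: "satisfies C \<C> m n P"
  proof (intro allI impI, elim conjE exE)
    fix N R h
    assume R: "R \<subseteq> nlists m (nlists N C)" "preserves (clone_power C N \<C>) m R"
      and h: "?hom (nlists N C) R h"
    show "?loops N R"
      by (rule satisfies_imp_pseudo_loop[OF plc cl assms(6) sat R h])
  qed
  have cd: ?d if c: ?c
  proof (intro allI impI, elim conjE exE)
    fix N R h
    assume "1 \<le> N" "R \<subseteq> nlists m (nlists N C)" "preserves (clone_power C N \<C>) m R"
      and "?hom (nlists N C) R h"
    then show "?loops N R"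
      by (intro c[rule_format, of N R] conjI exI[of _ h])
  qed
  \<comment> \<open>With two distinct elements \<open>a\<close> and \<open>b\<close>, every finite
    \<open>F\<close> is enlarged by them so that assignments separate variables; the local solution
    then restricts to \<open>F\<close>. Otherwise the identities hold trivially.\<close>
  have db: "satisfies C \<C> m n P" if d: ?d
  proof (cases "\<exists>a\<in>C. \<exists>b\<in>C. a \<noteq> b")
    case True
    then obtain a b where xy: "a \<in> C" "b \<in> C" "a \<noteq> b"
      by (elim bexE)
    have "satisfies_on \<C> m n P F" if F: "finite F" "F \<subseteq> C" for F
    proof (rule satisfies_on_mono[where G = "insert a (insert b F)"])
      show "satisfies_on \<C> m n P (insert a (insert b F))"
        by (rule pseudo_loops_imp_satisfies_on[OF plc cl _ _ _ _ xy(3) d]) (use F xy in simp_all)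
    qed (simp add: subset_insertI2)
    then have "satisfies_locally C \<C> m n P"
      unfolding satisfies_locally_def by (intro allI impI) (elim conjE)
    then show ?thesis
      by (rule ab)
  next
    case False
    then show ?thesis
      by (intro satisfies_subsingleton[OF plc cl]) blast
  qed
  show ?thesis
  proof (intro conjI)
    show "satisfies_locally C \<C> m n P \<longleftrightarrow> satisfies C \<C> m n P"
      using ab ba by (rule iffI)
    show "satisfies C \<C> m n P \<longleftrightarrow> ?c"
      using bc db[OF cd] by (rule iffI)
    show "satisfies C \<C> m n P \<longleftrightarrow> ?d"
      using cd[OF bc] db by (rule iffI)
  qed
qed

end
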